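(* Let $I\subset\mathbb{R}$ be an open interval and let $\alpha:I\to E^3$ be a unit speed rectifying slant helix with curvature $\kappa$, torsion $\tau$ and principal normal $n$. Let $\theta$ be the constant angle that $n$ makes with a fixed unit vector $u$, i.e. $g(n(s),u)=\cos(\theta)$ for all $s\in I$, and let $c_1\neq 0$ and $c_2$ be the real constants such that $\tau(s)/\kappa(s)=c_1s+c_2$ for all $s\in I$. Then the vector $v=\dfrac{n'}{\kappa}$ satisfies the second order linear vector differential equation $$v''(s)+\frac{(c_1\tan(\theta))^2}{\left(1+(c_1s+c_2)^2\right)^2}\,v(s)=0\qquad (s\in I).$$
   Context: $E^3$ is $\mathbb{R}^3$ with the Euclidean metric $g$. Curves are unit speed (parametrized by arclength $s$, $g(\alpha',\alpha')=1$), have at least four continuous derivatives, and satisfy $t'(s)\neq 0$ for all $s$ (where $t=\alpha'$), so that the Frenet frame $\{t,n,b\}$ is defined, with $t'=\kappa n$, $n'=-\kappa t+\tau b$, $b'=-\tau n$, and $\kappa>0$. A curve is a slant helix if its principal normal vector field $n$ makes a constant angle with a fixed line in space, i.e. there is a fixed unit vector $u$ with $g(n(s),u)$ constant. A rectifying slant helix is a unit speed slant helix whose position vector always lies in its rectifying plane, i.e. $\alpha(s)=\lambda(s)t(s)+\mu(s)b(s)$ for some functions $\lambda,\mu$. It is known (Chen) that for a unit speed rectifying curve one has $\tau(s)/\kappa(s)=c_1s+c_2$ for some constants $c_1\neq 0$ and $c_2$. *)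

theory Defs
  imports "HOL-Analysis.Analysis"
begin

abbreviation vderiv :: "(real \<Rightarrow> 'a::real_normed_vector) \<Rightarrow> real \<Rightarrow> 'a" where
  "vderiv f \<equiv> (\<lambda>s. vector_derivative f (at s))"

text \<open>The following notion is meant for open sets: \<^const>\<open>vector_derivative\<close> is
  unspecified at points of non-differentiability, so the existence of the derivatives
  is demanded explicitly.\<close>

definition Ck_on :: "nat \<Rightarrow> real set \<Rightarrow> (real \<Rightarrow> 'a::real_normed_vector) \<Rightarrow> bool" where
  "Ck_on k I f \<longleftrightarrow>
     (\<forall>j<k. (vderiv ^^ j) f differentiable_on I) \<and> continuous_on I ((vderiv ^^ k) f)"

definition tangent :: "(real \<Rightarrow> real^3) \<Rightarrow> real \<Rightarrow> real^3" where
  "tangent \<alpha> s = vderiv \<alpha> s"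

definition curvature :: "(real \<Rightarrow> real^3) \<Rightarrow> real \<Rightarrow> real" where
  "curvature \<alpha> s = norm (vderiv (tangent \<alpha>) s)"

definition principal_normal :: "(real \<Rightarrow> real^3) \<Rightarrow> real \<Rightarrow> real^3" where
  "principal_normal \<alpha> s = vderiv (tangent \<alpha>) s /\<^sub>R curvature \<alpha> s"

definition binormal :: "(real \<Rightarrow> real^3) \<Rightarrow> real \<Rightarrow> real^3" where
  "binormal \<alpha> s = cross3 (tangent \<alpha> s) (principal_normal \<alpha> s)"

text \<open>Torsion is the coefficient in \<open>b' = - \<tau> n\<close>; since \<open>n\<close> is a unit vector it is
  obtained by taking the inner product with \<open>n\<close>.\<close>

definition torsion :: "(real \<Rightarrow> real^3) \<Rightarrow> real \<Rightarrow> real" where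
  "torsion \<alpha> s = - (vderiv (binormal \<alpha>) s \<bullet> principal_normal \<alpha> s)"

definition unit_speed_curve_on :: "real set \<Rightarrow> (real \<Rightarrow> real^3) \<Rightarrow> bool" where
  "unit_speed_curve_on I \<alpha> \<longleftrightarrow>
     Ck_on 4 I \<alpha> \<and>
     (\<forall>s\<in>I. tangent \<alpha> s \<bullet> tangent \<alpha> s = 1) \<and>
     (\<forall>s\<in>I. vderiv (tangent \<alpha>) s \<noteq> 0)"

definition slant_helix_on :: "real set \<Rightarrow> (real \<Rightarrow> real^3) \<Rightarrow> bool" where
  "slant_helix_on I \<alpha> \<longleftrightarrow>
     (\<exists>u. norm u = 1 \<and> (\<lambda>s. principal_normal \<alpha> s \<bullet> u) constant_on I)"

definition rectifying_on :: "real set \<Rightarrow> (real \<Rightarrow> real^3) \<Rightarrow> bool" where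
  "rectifying_on I \<alpha> \<longleftrightarrow>
     (\<exists>l m. \<forall>s\<in>I. \<alpha> s = l s *\<^sub>R tangent \<alpha> s + m s *\<^sub>R binormal \<alpha> s)"

definition rectifying_slant_helix_on :: "real set \<Rightarrow> (real \<Rightarrow> real^3) \<Rightarrow> bool" where
  "rectifying_slant_helix_on I \<alpha> \<longleftrightarrow>
     unit_speed_curve_on I \<alpha> \<and> slant_helix_on I \<alpha> \<and> rectifying_on I \<alpha>"

end

theory Submission
  imports Defs
begin

text \<open>
  Write \<open>f = \<tau> / \<kappa>\<close>, so \<open>f s = c\<^sub>1 s + c\<^sub>2\<close>. The Frenet equations
  (\<open>frenet_equations\<close>) give \<open>v = n' / \<kappa> = f b - t\<close>. Differentiating this,
  the derivatives of \<open>t\<close> and \<open>b\<close> contribute only multiples of \<open>n\<close>, whence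
  \<open>v' = c\<^sub>1 b - \<kappa> (1 + f\<^sup>2) n\<close>. In the next derivative the \<open>n'\<close> term contributes
  \<open>- \<kappa>\<^sup>2 (1 + f\<^sup>2) v\<close>, and what remains is a multiple of \<open>n\<close> with coefficient
  \<open>- (\<kappa>' (1 + f\<^sup>2) + 3 c\<^sub>1 f \<kappa>)\<close>, which is proportional to the derivative of
  \<open>\<kappa>\<^sup>2 (1 + f\<^sup>2)\<^sup>3\<close>.

  Everything therefore rests on the identity \<open>\<kappa>\<^sup>2 (1 + f\<^sup>2)\<^sup>3 = (c\<^sub>1 tan \<theta>)\<^sup>2\<close>
  (\<open>slant_helix_curvature\<close>): being constant, its left side kills the \<open>n\<close> term,
  and its value turns \<open>\<kappa>\<^sup>2 (1 + f\<^sup>2)\<close> into the coefficient of the differential equation.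
  The identity holds because \<open>n \<bullet> u\<close> is constant: differentiating twice shows that \<open>v\<close>
  and \<open>v'\<close> are orthogonal to \<open>u\<close>, which determines the components of the unit vector \<open>u\<close>
  along \<open>t\<close> and \<open>b\<close> in terms of \<open>\<kappa>\<close>, \<open>f\<close> and \<open>cos \<theta>\<close>;
  the Pythagorean theorem in the Frenet frame does the rest.
\<close>

section \<open>Orthonormal frames and constant inner products\<close>

text \<open>The difference of the two sides is orthogonal to \<open>t \<times> n\<close>, and by the triple product
  formula its cross product with \<open>t \<times> n\<close> is zero as well; only the zero vector is both
  orthogonal and parallel to a nonzero vector.\<close>

lemma orthonormal_cross3_expansion:
  fixes t n x :: "real^3"
  assumes "t \<bullet> t = 1" "n \<bullet> n = 1" "t \<bullet> n = 0"
  defines "b \<equiv> cross3 t n"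
  shows "x = (x \<bullet> t) *\<^sub>R t + (x \<bullet> n) *\<^sub>R n + (x \<bullet> b) *\<^sub>R b"
proof -
  define w where "w = x - ((x \<bullet> t) *\<^sub>R t + (x \<bullet> n) *\<^sub>R n + (x \<bullet> b) *\<^sub>R b)"
  have bt: "b \<bullet> t = 0" "b \<bullet> n = 0"
    by (simp_all add: b_def dot_cross_self inner_commute[of "cross3 t n"])
  have bb: "b \<bullet> b = 1"
    using norm_cross_dot[of t n] assms(1-3)
    by (simp add: b_def power2_norm_eq_inner power_mult_distrib)
  have w: "w \<bullet> t = 0" "w \<bullet> n = 0" "w \<bullet> b = 0"
    using assms(1-3) bt bb
    by (simp_all add: w_def inner_simps inner_commute)
  have "cross3 w b = (w \<bullet> n) *\<^sub>R t - (w \<bullet> t) *\<^sub>R n"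
    unfolding b_def by (rule Lagrange)
  then have "cross3 w b = 0" using w by simp
  moreover have "b \<noteq> 0" using bb by auto
  ultimately have "w = 0" using w(3) norm_and_cross_eq_0 by blast
  then show ?thesis by (simp add: w_def)
qed

lemma has_vector_derivative_cross3:
  assumes "(f has_vector_derivative f') (at x)" "(g has_vector_derivative g') (at x)"
  shows "((\<lambda>x. cross3 (f x) (g x)) has_vector_derivative
           cross3 (f x) g' + cross3 f' (g x)) (at x)"
  using bounded_bilinear.has_vector_derivative[OF
      bilinear_cross[unfolded bilinear_conv_bounded_bilinear] assms] .

lemma constant_inner_derivative:
  fixes f g :: "real \<Rightarrow> 'a::real_inner"
  assumes "(f has_vector_derivative f') (at s)" "(g has_vector_derivative g') (at s)"
    and "open I" "s \<in> I" "\<And>r. r \<in> I \<Longrightarrow> f r \<bullet> g r = c"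
  shows "f s \<bullet> g' + f' \<bullet> g s = 0"
proof -
  have "((\<lambda>r. f r \<bullet> g r) has_vector_derivative f s \<bullet> g' + f' \<bullet> g s) (at s)"
    using bounded_bilinear.has_vector_derivative[OF bounded_bilinear_inner assms(1,2)] .
  moreover have "((\<lambda>r. f r \<bullet> g r) has_vector_derivative 0) (at s)"
    by (rule has_vector_derivative_transform_within_open[OF _ assms(3,4), of "\<lambda>_. c"])
      (simp_all add: assms(5))
  ultimately show ?thesis by (rule vector_derivative_unique_at)
qed

section \<open>The Frenet apparatus\<close>

lemma unit_speed_curve_derivatives:
  assumes "open I" "unit_speed_curve_on I \<alpha>" "s \<in> I"
  shows "(tangent \<alpha> has_vector_derivative vderiv (tangent \<alpha>) s) (at s)"
    and "vderiv (tangent \<alpha>) differentiable (at s)"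
proof -
  have T: "tangent \<alpha> = vderiv \<alpha>" by (rule ext) (simp add: tangent_def)
  have D: "(vderiv ^^ j) \<alpha> differentiable (at s)" if "j < 4" for j
    using assms that differentiable_on_eq_differentiable_at[OF assms(1)]
    unfolding unit_speed_curve_on_def Ck_on_def by blast
  show "(tangent \<alpha> has_vector_derivative vderiv (tangent \<alpha>) s) (at s)"
    using D[of 1] by (simp add: T flip: vector_derivative_works)
  show "vderiv (tangent \<alpha>) differentiable (at s)"
    using D[of 2] by (simp add: T numeral_2_eq_2)
qed

lemma curvature_pos:
  assumes "unit_speed_curve_on I \<alpha>" "s \<in> I"
  shows "curvature \<alpha> s > 0"
  using assms by (simp add: unit_speed_curve_on_def curvature_def)

lemma curvature_scaleR_principal_normal:
  assumes "unit_speed_curve_on I \<alpha>" "s \<in> I"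
  shows "curvature \<alpha> s *\<^sub>R principal_normal \<alpha> s = vderiv (tangent \<alpha>) s"
  using curvature_pos[OF assms] by (simp add: principal_normal_def)

text \<open>The normal is orthogonal to the tangent because the tangent has constant length.\<close>

lemma frenet_frame_orthonormal:
  assumes "open I" "unit_speed_curve_on I \<alpha>" "s \<in> I"
  shows "tangent \<alpha> s \<bullet> tangent \<alpha> s = 1"
    and "principal_normal \<alpha> s \<bullet> principal_normal \<alpha> s = 1"
    and "tangent \<alpha> s \<bullet> principal_normal \<alpha> s = 0"
proof -
  have tt: "\<And>r. r \<in> I \<Longrightarrow> tangent \<alpha> r \<bullet> tangent \<alpha> r = 1"
    using assms(2) by (simp add: unit_speed_curve_on_def)
  show "tangent \<alpha> s \<bullet> tangent \<alpha> s = 1" using tt assms(3) .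
  have "norm (principal_normal \<alpha> s) = 1"
    using curvature_pos[OF assms(2,3)] by (simp add: principal_normal_def curvature_def)
  then show "principal_normal \<alpha> s \<bullet> principal_normal \<alpha> s = 1"
    by (simp add: norm_eq_1)
  note T' = unit_speed_curve_derivatives(1)[OF assms]
  have "tangent \<alpha> s \<bullet> vderiv (tangent \<alpha>) s = 0"
    using constant_inner_derivative[OF T' T' assms(1,3) tt] by (simp add: inner_commute)
  then show "tangent \<alpha> s \<bullet> principal_normal \<alpha> s = 0"
    by (simp add: principal_normal_def)
qed

lemma curvature_differentiable:
  assumes "open I" "unit_speed_curve_on I \<alpha>" "s \<in> I"
  shows "curvature \<alpha> differentiable (at s)"
proof -
  have C: "curvature \<alpha> = norm \<circ> vderiv (tangent \<alpha>)"
    by (rule ext) (simp add: curvature_def)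
  have "vderiv (tangent \<alpha>) s \<noteq> 0"
    using assms(2,3) by (simp add: unit_speed_curve_on_def)
  then show ?thesis
    unfolding C
    by (intro differentiable_chain_at unit_speed_curve_derivatives(2)[OF assms]
        differentiable_norm_at)
qed

text \<open>The expansion of \<open>n'\<close> in the frame has \<open>t\<close>-coefficient \<open>- t' \<bullet> n\<close> and vanishing
  \<open>n\<close>-coefficient, since \<open>t \<bullet> n\<close> and \<open>n \<bullet> n\<close> are constant. In \<open>b' = t \<times> n' + t' \<times> n\<close> the
  second summand vanishes, so \<open>b'\<close> is the multiple \<open>- (n' \<bullet> b)\<close> of \<open>n\<close>, which identifies the
  torsion with \<open>n' \<bullet> b\<close>.\<close>

lemma frenet_equations:
  assumes "open I" "unit_speed_curve_on I \<alpha>" "s \<in> I"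
  shows "(tangent \<alpha> has_vector_derivative curvature \<alpha> s *\<^sub>R principal_normal \<alpha> s) (at s)"
    and "(principal_normal \<alpha> has_vector_derivative
           torsion \<alpha> s *\<^sub>R binormal \<alpha> s - curvature \<alpha> s *\<^sub>R tangent \<alpha> s) (at s)"
    and "(binormal \<alpha> has_vector_derivative - (torsion \<alpha> s *\<^sub>R principal_normal \<alpha> s)) (at s)"
proof -
  let ?t = "tangent \<alpha> s" and ?n = "principal_normal \<alpha> s" and ?b = "binormal \<alpha> s"
  let ?k = "curvature \<alpha> s"
  note on = frenet_frame_orthonormal[OF assms(1,2)]
  show t': "(tangent \<alpha> has_vector_derivative ?k *\<^sub>R ?n) (at s)"
    using unit_speed_curve_derivatives(1)[OF assms]
      curvature_scaleR_principal_normal[OF assms(2,3)] by simp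
  have N: "principal_normal \<alpha> = (\<lambda>r. inverse (curvature \<alpha> r) *\<^sub>R vderiv (tangent \<alpha>) r)"
    by (rule ext) (simp add: principal_normal_def)
  have "principal_normal \<alpha> differentiable (at s)"
    unfolding N using curvature_pos[OF assms(2,3)]
    by (intro differentiable_scaleR differentiable_inverse curvature_differentiable[OF assms]
        unit_speed_curve_derivatives(2)[OF assms]) simp
  then obtain n' where n': "(principal_normal \<alpha> has_vector_derivative n') (at s)"
    using vector_derivative_works by blast
  have nn: "n' \<bullet> ?n = 0"
    using constant_inner_derivative[OF n' n' assms(1,3) on(2)] by (simp add: inner_commute)
  have nt: "n' \<bullet> ?t = - ?k"
    using constant_inner_derivative[OF t' n' assms(1,3) on(3)] on(2)[OF assms(3)]
    by (simp add: inner_commute)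
  have n'_eq: "n' = (n' \<bullet> ?b) *\<^sub>R ?b - ?k *\<^sub>R ?t"
    using orthonormal_cross3_expansion[OF on[OF assms(3)], of n'] nn nt
    by (simp add: binormal_def)
  have tb: "cross3 ?t ?b = - ?n"
    unfolding binormal_def Lagrange using on[OF assms(3)] by simp
  have B: "binormal \<alpha> = (\<lambda>r. cross3 (tangent \<alpha> r) (principal_normal \<alpha> r))"
    by (rule ext) (simp add: binormal_def)
  have "cross3 ?t n' + cross3 (?k *\<^sub>R ?n) ?n = cross3 ?t n'"
    by (simp add: cross_mult_left)
  also have "\<dots> = - ((n' \<bullet> ?b) *\<^sub>R ?n)"
    by (subst n'_eq) (simp add: Cross3.right_diff_distrib cross_mult_right tb)
  finally have b': "(binormal \<alpha> has_vector_derivative - ((n' \<bullet> ?b) *\<^sub>R ?n)) (at s)"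
    using has_vector_derivative_cross3[OF t' n'] by (simp add: B)
  have tau: "torsion \<alpha> s = n' \<bullet> ?b"
    using vector_derivative_at[OF b'] on(2)[OF assms(3)] by (simp add: torsion_def)
  show "(principal_normal \<alpha> has_vector_derivative torsion \<alpha> s *\<^sub>R ?b - ?k *\<^sub>R ?t) (at s)"
    using n' n'_eq tau by simp
  show "(binormal \<alpha> has_vector_derivative - (torsion \<alpha> s *\<^sub>R ?n)) (at s)"
    using b' tau by simp
qed

section \<open>Curves whose ratio of torsion to curvature is affine\<close>

text \<open>On such a curve \<open>n' / \<kappa>\<close> equals the following vector field \<open>f b - t\<close>.\<close>

lemma affine_ratio_field_derivative:
  assumes "open I" "unit_speed_curve_on I \<alpha>" "s \<in> I"
    and "\<forall>s\<in>I. torsion \<alpha> s / curvature \<alpha> s = c\<^sub>1 * s + c\<^sub>2"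
  shows "((\<lambda>s. (c\<^sub>1 * s + c\<^sub>2) *\<^sub>R binormal \<alpha> s - tangent \<alpha> s) has_vector_derivative
    c\<^sub>1 *\<^sub>R binormal \<alpha> s
      - (curvature \<alpha> s * (1 + (c\<^sub>1 * s + c\<^sub>2)\<^sup>2)) *\<^sub>R principal_normal \<alpha> s) (at s)"
proof -
  note F = frenet_equations[OF assms(1-3)]
  have tau: "torsion \<alpha> s = (c\<^sub>1 * s + c\<^sub>2) * curvature \<alpha> s"
    using curvature_pos[OF assms(2,3)] assms(3,4) by (metis less_irrefl nonzero_eq_divide_eq)
  have lin: "((\<lambda>s. c\<^sub>1 * s + c\<^sub>2) has_field_derivative c\<^sub>1) (at s)"
    by (auto intro!: derivative_eq_intros)
  show ?thesis
    by (rule has_vector_derivative_eq_rhs[OF has_vector_derivative_diff[OF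
            has_vector_derivative_scaleR[OF lin F(3)] F(1)]])
      (simp add: tau vec_eq_iff algebra_simps power2_eq_square)
qed

text \<open>Since \<open>n \<bullet> u\<close> is constant, \<open>n'\<close> and hence \<open>f b - t\<close> is orthogonal to \<open>u\<close>, and
  then so is the derivative of \<open>f b - t\<close>. With \<open>y = b \<bullet> u\<close> this means \<open>t \<bullet> u = f y\<close> and
  \<open>c\<^sub>1 y = \<kappa> (1 + f\<^sup>2) cos \<theta>\<close>. As \<open>u\<close> is a unit vector, \<open>(1 + f\<^sup>2) y\<^sup>2 = (sin \<theta>)\<^sup>2\<close>, and
  eliminating \<open>y\<close> gives the claim. The cosine is nonzero, for otherwise \<open>y = 0\<close> and the sine
  would vanish too.\<close>

lemma slant_helix_curvature:
  assumes "open I" "unit_speed_curve_on I \<alpha>" "s \<in> I"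
    and "norm u = 1" "\<forall>s\<in>I. principal_normal \<alpha> s \<bullet> u = cos \<theta>" "c\<^sub>1 \<noteq> 0"
    and "\<forall>s\<in>I. torsion \<alpha> s / curvature \<alpha> s = c\<^sub>1 * s + c\<^sub>2"
  shows "(curvature \<alpha> s)\<^sup>2 * (1 + (c\<^sub>1 * s + c\<^sub>2)\<^sup>2) ^ 3 = (c\<^sub>1 * tan \<theta>)\<^sup>2"
proof -
  define k where "k = curvature \<alpha> s"
  define f where "f = c\<^sub>1 * s + c\<^sub>2"
  define y where "y = binormal \<alpha> s \<bullet> u"
  let ?w = "\<lambda>s. (c\<^sub>1 * s + c\<^sub>2) *\<^sub>R binormal \<alpha> s - tangent \<alpha> s"
  note const = has_vector_derivative_const[of u]
  have w_orth: "?w r \<bullet> u = 0" if "r \<in> I" for r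
  proof -
    have k: "curvature \<alpha> r \<noteq> 0" using curvature_pos[OF assms(2) that] by simp
    then have tau: "torsion \<alpha> r = curvature \<alpha> r * (c\<^sub>1 * r + c\<^sub>2)"
      using assms(7) that by (metis mult.commute nonzero_eq_divide_eq)
    have "(torsion \<alpha> r *\<^sub>R binormal \<alpha> r - curvature \<alpha> r *\<^sub>R tangent \<alpha> r) \<bullet> u = 0"
      using constant_inner_derivative[OF frenet_equations(2)[OF assms(1,2) that] const
          assms(1) that] assms(5) by simp
    then have "curvature \<alpha> r * (?w r \<bullet> u) = 0"
      by (simp add: tau inner_simps algebra_simps)
    then show ?thesis using k by simp
  qed
  then have x: "tangent \<alpha> s \<bullet> u = f * y"
    using assms(3) by (fastforce simp: inner_simps y_def f_def)
  have "(c\<^sub>1 *\<^sub>R binormal \<alpha> s - (k * (1 + f\<^sup>2)) *\<^sub>R principal_normal \<alpha> s) \<bullet> u = 0"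
    using constant_inner_derivative[OF affine_ratio_field_derivative[OF assms(1-3,7)] const
        assms(1,3) w_orth] by (simp add: k_def f_def)
  then have y: "c\<^sub>1 * y = k * (1 + f\<^sup>2) * cos \<theta>"
    using assms(3,5) by (simp add: inner_simps y_def)
  have "u \<bullet> u = (tangent \<alpha> s \<bullet> u)\<^sup>2 + (principal_normal \<alpha> s \<bullet> u)\<^sup>2 + y\<^sup>2"
    by (subst (1) orthonormal_cross3_expansion[OF frenet_frame_orthonormal[OF assms(1-3)], of u])
      (simp add: inner_simps y_def binormal_def power2_eq_square inner_commute)
  then have "(1 + f\<^sup>2) * y\<^sup>2 = 1 - (cos \<theta>)\<^sup>2"
    using assms(3,4,5) x by (simp add: norm_eq_1 power_mult_distrib algebra_simps)
  then have sin: "(1 + f\<^sup>2) * y\<^sup>2 = (sin \<theta>)\<^sup>2"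
    by (simp add: sin_squared_eq)
  have cos: "cos \<theta> \<noteq> 0"
  proof
    assume "cos \<theta> = 0"
    then have "sin \<theta> = 0" using sin y assms(6) by simp
    with \<open>cos \<theta> = 0\<close> show False using sin_cos_squared_add[of \<theta>] by simp
  qed
  have "(c\<^sub>1 * sin \<theta>)\<^sup>2 = (1 + f\<^sup>2) * (c\<^sub>1 * y)\<^sup>2"
    using sin by (simp add: power_mult_distrib algebra_simps)
  also have "\<dots> = k\<^sup>2 * (1 + f\<^sup>2) ^ 3 * (cos \<theta>)\<^sup>2"
    unfolding y by (simp add: power_mult_distrib power2_eq_square power3_eq_cube)
  finally have "(c\<^sub>1 * sin \<theta>)\<^sup>2 / (cos \<theta>)\<^sup>2 = k\<^sup>2 * (1 + f\<^sup>2) ^ 3"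
    using cos by simp
  then show ?thesis
    by (simp add: tan_def power_mult_distrib power_divide k_def f_def)
qed

theorem theorem5:
  fixes I :: "real set" and \<alpha> v :: "real \<Rightarrow> real^3" and u :: "real^3"
    and \<theta> c\<^sub>1 c\<^sub>2 :: real
  assumes "open I" and "is_interval I"
    and "rectifying_slant_helix_on I \<alpha>"
    and "norm u = 1"
    and "\<forall>s\<in>I. principal_normal \<alpha> s \<bullet> u = cos \<theta>"
    and "c\<^sub>1 \<noteq> 0"
    and "\<forall>s\<in>I. torsion \<alpha> s / curvature \<alpha> s = c\<^sub>1 * s + c\<^sub>2"
    and "\<forall>s\<in>I. v s = vderiv (principal_normal \<alpha>) s /\<^sub>R curvature \<alpha> s"
  shows "v differentiable_on I \<and> vderiv v differentiable_on I \<and>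
    (\<forall>s\<in>I. vderiv (vderiv v) s
       + ((c\<^sub>1 * tan \<theta>)\<^sup>2 / (1 + (c\<^sub>1 * s + c\<^sub>2)\<^sup>2)\<^sup>2) *\<^sub>R v s = 0)"
proof -
  let ?f = "\<lambda>s. c\<^sub>1 * s + c\<^sub>2" and ?k = "curvature \<alpha>"
  let ?t = "tangent \<alpha>" and ?n = "principal_normal \<alpha>" and ?b = "binormal \<alpha>"
  let ?v' = "\<lambda>s. c\<^sub>1 *\<^sub>R ?b s - (?k s * (1 + (?f s)\<^sup>2)) *\<^sub>R ?n s"
  have curve: "unit_speed_curve_on I \<alpha>"
    using assms(3) by (simp add: rectifying_slant_helix_on_def)
  have tau: "torsion \<alpha> s = ?f s * ?k s" if "s \<in> I" for s
    using curvature_pos[OF curve that] assms(7) that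
    by (metis less_irrefl nonzero_eq_divide_eq)
  have v_eq: "v s = ?f s *\<^sub>R ?b s - ?t s" if "s \<in> I" for s
    using assms(8) that curvature_pos[OF curve that]
      vector_derivative_at[OF frenet_equations(2)[OF assms(1) curve that]]
    by (simp add: tau scaleR_diff_right)
  have v': "(v has_vector_derivative ?v' s) (at s)" if "s \<in> I" for s
    by (rule has_vector_derivative_transform_within_open[OF
          affine_ratio_field_derivative[OF assms(1) curve that assms(7)] assms(1) that])
      (simp add: v_eq)
  have v'': "(vderiv v has_vector_derivative
      - (((c\<^sub>1 * tan \<theta>)\<^sup>2 / (1 + (?f s)\<^sup>2)\<^sup>2) *\<^sub>R v s)) (at s)" if s: "s \<in> I" for s
  proof -
    define f where "f = ?f s"
    define k where "k = ?k s"
    have pos: "1 + f\<^sup>2 > 0" by (simp add: add_pos_nonneg)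
    have kpos: "k > 0" using curvature_pos[OF curve s] by (simp add: k_def)
    obtain k' where k': "(?k has_field_derivative k') (at s)"
      using curvature_differentiable[OF assms(1) curve s]
      by (auto simp: real_differentiable_def)
    have K: "?k r ^ 2 * (1 + (?f r)\<^sup>2) ^ 3 = (c\<^sub>1 * tan \<theta>)\<^sup>2" if "r \<in> I" for r
      using slant_helix_curvature[OF assms(1) curve that assms(4-7)] .
    have "((\<lambda>r. ?k r ^ 2 * (1 + (?f r)\<^sup>2) ^ 3) has_field_derivative
        2 * k * (1 + f\<^sup>2)\<^sup>2 * (k' * (1 + f\<^sup>2) + 3 * c\<^sub>1 * f * k)) (at s)"
      by (rule derivative_eq_intros k' refl)+
        (simp add: f_def k_def algebra_simps power2_eq_square power3_eq_cube)
    moreover have "((\<lambda>r. ?k r ^ 2 * (1 + (?f r)\<^sup>2) ^ 3) has_field_derivative 0) (at s)"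
      by (rule has_field_derivative_transform_within_open[OF DERIV_const assms(1) s])
        (simp add: K)
    ultimately have "2 * k * (1 + f\<^sup>2)\<^sup>2 * (k' * (1 + f\<^sup>2) + 3 * c\<^sub>1 * f * k) = 0"
      by (rule DERIV_unique)
    then have n_coeff: "k' * (1 + f\<^sup>2) + 3 * c\<^sub>1 * f * k = 0"
      using pos kpos by simp
    have coeff: "((\<lambda>r. ?k r * (1 + (?f r)\<^sup>2)) has_field_derivative
        k' * (1 + f\<^sup>2) + k * (2 * f * c\<^sub>1)) (at s)"
      by (rule derivative_eq_intros k' refl)+
        (simp add: f_def k_def algebra_simps)
    have C: "(c\<^sub>1 * tan \<theta>)\<^sup>2 / (1 + f\<^sup>2)\<^sup>2 = k\<^sup>2 * (1 + f\<^sup>2)"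
    proof -
      have "(c\<^sub>1 * tan \<theta>)\<^sup>2 = k\<^sup>2 * (1 + f\<^sup>2) * (1 + f\<^sup>2)\<^sup>2"
        using K[OF s, folded f_def k_def] by (simp add: power2_eq_square power3_eq_cube)
      then show ?thesis using pos by simp
    qed
    have "(?v' has_vector_derivative
        c\<^sub>1 *\<^sub>R - ((f * k) *\<^sub>R ?n s)
        - ((k * (1 + f\<^sup>2)) *\<^sub>R ((f * k) *\<^sub>R ?b s - k *\<^sub>R ?t s)
           + (k' * (1 + f\<^sup>2) + k * (2 * f * c\<^sub>1)) *\<^sub>R ?n s)) (at s)"
      using has_vector_derivative_diff[OF
          bounded_linear.has_vector_derivative[OF bounded_linear_scaleR_right
            frenet_equations(3)[OF assms(1) curve s]]
          has_vector_derivative_scaleR[OF coeff frenet_equations(2)[OF assms(1) curve s]]]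
      by (simp add: tau[OF s] f_def k_def)
    also have "c\<^sub>1 *\<^sub>R - ((f * k) *\<^sub>R ?n s)
        - ((k * (1 + f\<^sup>2)) *\<^sub>R ((f * k) *\<^sub>R ?b s - k *\<^sub>R ?t s)
           + (k' * (1 + f\<^sup>2) + k * (2 * f * c\<^sub>1)) *\<^sub>R ?n s)
      = - ((k\<^sup>2 * (1 + f\<^sup>2)) *\<^sub>R (f *\<^sub>R ?b s - ?t s))
        - (k' * (1 + f\<^sup>2) + 3 * c\<^sub>1 * f * k) *\<^sub>R ?n s"
      by (simp add: vec_eq_iff algebra_simps power2_eq_square)
    also have "\<dots> = - ((k\<^sup>2 * (1 + f\<^sup>2)) *\<^sub>R v s)"
      using n_coeff by (simp add: v_eq[OF s] f_def)
    finally have "(?v' has_vector_derivative - ((k\<^sup>2 * (1 + f\<^sup>2)) *\<^sub>R v s)) (at s)" .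
    then have "(vderiv v has_vector_derivative - ((k\<^sup>2 * (1 + f\<^sup>2)) *\<^sub>R v s)) (at s)"
      by (rule has_vector_derivative_transform_within_open[OF _ assms(1) s])
        (simp add: vector_derivative_at[OF v'])
    then show ?thesis using C by (simp add: f_def)
  qed
  have "v differentiable_on I" "vderiv v differentiable_on I"
    using v' v'' by (blast intro: differentiable_at_imp_differentiable_on differentiableI_vector)+
  moreover have "\<forall>s\<in>I. vderiv (vderiv v) s
       + ((c\<^sub>1 * tan \<theta>)\<^sup>2 / (1 + (c\<^sub>1 * s + c\<^sub>2)\<^sup>2)\<^sup>2) *\<^sub>R v s = 0"
    using vector_derivative_at[OF v''] by simp
  ultimately show ?thesis by blast
qed

end
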